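(* Let $x_1,x_2,x_3,x_4$ be prime numbers and let $a,b$ be positive integers such that (i) $x_1+x_2+x_3+x_4=a^2$; (ii) $\sum_{i=1}^{4}\mathrm{dgs}(x_i)=b^2$; (iii) $\mathrm{dgs}(a^2)+\mathrm{dgs}(b^2)=\mathrm{dgs}(a^2+b^2)$; (iv) $a^2+b^2$ is a prime of the form $4s+1$ for some positive integer $s$. Then $b>3$.
   Context: For a positive integer $n$, $\mathrm{dgs}(n)$ denotes the sum of all digits of $n$ in its decimal representation. The primes $x_1,\dots,x_4$ need not be distinct. *)

theory Defs
  imports "HOL-Computational_Algebra.Primes"
begin

(* Sum of the decimal digits: n mod 10 is the last digit of n, and n div 10 is n
   with its last digit removed. *)
fun dgs :: "nat \<Rightarrow> nat" where
  "dgs n = (if n < 10 then n else dgs (n div 10) + n mod 10)"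

(* The unconditional recursion equation loops as a rewrite rule. *)
declare dgs.simps [simp del]

end

(* Modulo 9 a number agrees with its digit sum, so (i) and (ii) give a^2 = b^2 mod 9; for b = 3
   the prime a^2 + b^2 > 3 would be divisible by 3. Every prime has digit sum at least 2,
   because a prime above 10 is odd and so has nonzero first and last digits; hence b^2 >= 8. *)
theory Submission
  imports Defs
begin

text \<open>Since 10 = 1 mod 9, splitting off the last digit preserves the residue.\<close>

lemma dgs_mod_9: "dgs n mod 9 = n mod 9"
proof (induction n rule: less_induct)
  case (less n)
  show ?case
  proof (cases "n < 10")
    case True
    then show ?thesis by (simp add: dgs.simps)
  next
    case False
    have "dgs n = dgs (n div 10) + n mod 10"
      using False by (simp add: dgs.simps[of n])
    moreover have "dgs (n div 10) mod 9 = n div 10 mod 9"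
      using False by (intro less.IH) simp
    ultimately have "dgs n mod 9 = (n div 10 + n mod 10) mod 9"
      by (metis mod_add_left_eq)
    \<comment> \<open>Adding this multiple of 9 restores the decimal decomposition
      \<open>10 * (n div 10) + n mod 10\<close>.\<close>
    also have "\<dots> = (9 * (n div 10) + (n div 10 + n mod 10)) mod 9"
      by (rule mod_mult_self4[symmetric])
    also have "9 * (n div 10) + (n div 10 + n mod 10) = n"
      by presburger
    finally show ?thesis .
  qed
qed

text \<open>Dropping the last digit of a number \<ge> 10 leaves a positive number, so the leading
  digit survives to the base case.\<close>

lemma dgs_pos: "n > 0 \<Longrightarrow> dgs n > 0"
proof (induction n rule: less_induct)
  case (less n)
  show ?case
  proof (cases "n < 10")
    case True
    then show ?thesis using less.prems by (simp add: dgs.simps)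
  next
    case False
    then have "dgs (n div 10) > 0" by (intro less.IH) auto
    then show ?thesis using False by (simp add: dgs.simps[of n])
  qed
qed

lemma dgs_prime_ge_2:
  assumes "prime p"
  shows "dgs p \<ge> 2"
proof (cases "p < 10")
  case True
  then show ?thesis using prime_ge_2_nat[OF assms] by (simp add: dgs.simps)
next
  case False
  \<comment> \<open>An even prime would equal 2, against \<open>p\<close> \<ge> 10.\<close>
  have "\<not> 2 dvd p"
    using False assms primes_dvd_imp_eq[OF two_is_prime_nat assms] by auto
  then have "p mod 10 > 0" by presburger
  moreover have "dgs (p div 10) > 0"
    using False by (intro dgs_pos) simp
  ultimately show ?thesis using False by (simp add: dgs.simps[of p])
qed

theorem proposition4p1:
  fixes x\<^sub>1 x\<^sub>2 x\<^sub>3 x\<^sub>4 a b :: nat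
  assumes "prime x\<^sub>1" "prime x\<^sub>2" "prime x\<^sub>3" "prime x\<^sub>4"
    and "a > 0" "b > 0"
    and "x\<^sub>1 + x\<^sub>2 + x\<^sub>3 + x\<^sub>4 = a ^ 2"
    and "dgs x\<^sub>1 + dgs x\<^sub>2 + dgs x\<^sub>3 + dgs x\<^sub>4 = b ^ 2"
    and "dgs (a ^ 2) + dgs (b ^ 2) = dgs (a ^ 2 + b ^ 2)"
    and "prime (a ^ 2 + b ^ 2)"
    and "\<exists>s>0. a ^ 2 + b ^ 2 = 4 * s + 1"
  shows "b > 3"
proof (rule ccontr)
  assume "\<not> b > 3"
  moreover have "b ^ 2 \<ge> 8"
    using assms(8) assms(1-4)[THEN dgs_prime_ge_2] by linarith
  then have "\<not> b \<le> 2"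
    using power_mono[of b 2 2] by auto
  ultimately have b: "b = 3" by simp
  \<comment> \<open>Both squares are four-term sums, compared term by term.\<close>
  have "b ^ 2 mod 9 = a ^ 2 mod 9"
    unfolding assms(7,8)[symmetric] by (intro mod_add_cong dgs_mod_9)
  then have "9 dvd a ^ 2"
    using b by (simp add: dvd_eq_mod_eq_0)
  \<comment> \<open>Here \<open>b ^ 2\<close> is 9 itself, so 9 divides both summands.\<close>
  then have "3 dvd a ^ 2 + b ^ 2"
    using b by (auto intro: dvd_add dvd_trans[of 3 9])
  moreover have "prime (3 :: nat)" by simp
  ultimately have "a ^ 2 + b ^ 2 = 3"
    using primes_dvd_imp_eq assms(10) by metis
  then show False using b by simp
qed

end
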